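(* Let $q$ be a prime power, let $H$ be a normalized generalized Hadamard matrix $\mathrm{GH}(q,v/q)$ of order $v$ over the additive group of $\mathbb{F}_q$, let $K$ be a multiplicative group and $\phi:\mathbb{F}_q\to K$ an isomorphism from the additive group of $\mathbb{F}_q$ onto $K$. Then the code $C_H$ is a generalized Hadamard full propelinear code (GHFP-code) if and only if $\phi(H)$ is cocyclic over some cocycle $\psi$, with extension group $E_\psi\cong R\cong (C_H,\star)$, where $R$ is a regular subgroup of $\mathrm{PAut}(\mathcal{E}_{\phi(H)})$. That is: (a) if $(C_H,\star)$ is a GHFP-code, then there are a group $G$ of order $v$ and a cocycle $\psi:G\times G\to K$ such that $\phi(H)$ is cocyclic with cocycle $\psi$ and $E_\psi\cong R\cong(C_H,\star)$ for some regular subgroup $R$ of $\mathrm{PAut}(\mathcal{E}_{\phi(H)})$; (b) conversely, if $\phi(H)$ is cocyclic with cocycle $\psi:G\times G\to K$, then $C_H$ has a full propelinear structure $\star$ with $(C_H,\star)\cong E_\psi\cong R$ for some regular subgroup $R$ of $\mathrm{PAut}(\mathcal{E}_{\phi(H)})$.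
   Context: Generalized Hadamard matrices and codes. A $v\times v$ matrix $H=(h_{ij})$ over the additive group $\mathbb{F}_q$, $q\mid v$, is a $\mathrm{GH}(q,v/q)$ if for all $i<j$ the multiset $\{h_{ik}-h_{jk}: 1\le k\le v\}$ contains each element of $\mathbb{F}_q$ exactly $v/q$ times. It is normalized if its first row and column are zero. $F_H\subseteq\mathbb{F}_q^v$ is the set of rows of $H$, and $C_H=\bigcup_{\alpha\in\mathbb{F}_q}(F_H+\alpha\mathbf{1})$, with $\mathbf 1$ the all-one vector; $C_H$ is called a generalized Hadamard code. Full propelinear codes. For $\pi\in\mathcal{S}_n$ and $y\in\mathbb{F}_q^n$, $\pi(y)=(y_{\pi^{-1}(1)},\dots,y_{\pi^{-1}(n)})$. A code $C\subseteq\mathbb{F}_q^n$ with $\mathbf 0\in C$ is full propelinear if to every $x\in C$ is assigned $\pi_x\in\mathcal{S}_n$ such that, writing $x\star y=x+\pi_x(y)$: (i) $x\star C=C$ for all $x\in C$; (ii) $\pi_{x\star y}=\pi_x\circ\pi_y$ for all $x,y\in C$; (iii) $\pi_x$ fixes no coordinate if $x\notin\{\alpha\mathbf 1:\alpha\in\mathbb{F}_q\}$, and $\pi_x=\mathrm{Id}$ if $x=\alpha\mathbf 1$ for some $\alpha\in\mathbb{F}_q$. Then $(C,\star)$ is a group with identity $\mathbf 0$; $\star$ is called a full propelinear structure. A GHFP-code is a generalized Hadamard code that is full propelinear. Cocycles. A (normalized) cocycle is a map $\psi:G\times G\to K$ ($G$ a finite group) with $\psi(g,h)\psi(gh,k)=\psi(g,hk)\psi(h,k)$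 and $\psi(g,1)=\psi(1,g)=1$. Its extension group $E_\psi$ is the set $\{(u,g):u\in K,g\in G\}$ with product $(u,g)(v,h)=(uv\,\psi(g,h),gh)$. A matrix with entries in $K$ is cocyclic with cocycle $\psi$ if, under some indexing of its rows and columns by $G$, it has entry $\psi(g,h)$ in position $(g,h)$. Automorphisms. $\phi(H)=[\phi(h_{ij})]$. With $K=\{k_0=1,\dots,k_{q-1}\}$, and $M$ a matrix over $K$, $\mathcal{E}_M=[k_ik_jM]_{0\le i,j\le q-1}$ (a $q\times q$ block matrix). $\mathrm{PAut}(A)$ is the group of pairs $(P,Q)$ of permutation matrices with $PAQ^{\top}=A$, with componentwise multiplication. A subgroup of $\mathrm{PAut}(A)$ is regular if its induced actions on the rows and on the columns of $A$ are both regular. *)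

theory Defs
  imports "Jordan_Normal_Form.Matrix" "HOL-Algebra.Coset"
    "HOL-Library.Cardinality" "HOL-Library.Multiset" "HOL-Combinatorics.Permutations"
begin

text \<open>
  The field with \<open>q\<close> elements is a type \<open>'f\<close> of classes \<open>field\<close> and \<open>finite\<close>, with \<open>q = CARD('f)\<close>.
  Rows, columns and coordinates are numbered from \<open>0\<close>, so \<open>S\<^sub>n\<close> consists of the permutations of
  \<open>{..<n}\<close>.
\<close>

definition additive_group :: "'f::ab_group_add monoid" where
  "additive_group = \<lparr>carrier = UNIV, mult = (+), one = 0\<rparr>"


section \<open>Generalized Hadamard matrices and codes\<close>

definition GH :: "nat \<Rightarrow> 'f::{field,finite} mat \<Rightarrow> bool" where
  "GH v H \<longleftrightarrow> 0 < v \<and> CARD('f) dvd v \<and> H \<in> carrier_mat v v \<and>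
     (\<forall>i j. i < j \<and> j < v \<longrightarrow>
        (\<forall>a. count {# H $$ (i,k) - H $$ (j,k). k \<in># mset_set {..<v} #} a = v div CARD('f)))"

definition normalized_mat :: "'f::zero mat \<Rightarrow> bool" where
  "normalized_mat H \<longleftrightarrow>
     (\<forall>j < dim_col H. H $$ (0,j) = 0) \<and> (\<forall>i < dim_row H. H $$ (i,0) = 0)"

definition all_one_vec :: "nat \<Rightarrow> 'f::one vec" where
  "all_one_vec n = vec n (\<lambda>_. 1)"

definition F_rows :: "'f mat \<Rightarrow> 'f vec set" where
  "F_rows H = set (rows H)"

definition C_code :: "'f::{field,finite} mat \<Rightarrow> 'f vec set" where
  "C_code H = (\<Union>\<alpha>. (\<lambda>x. x + \<alpha> \<cdot>\<^sub>v all_one_vec (dim_col H)) ` F_rows H)"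

definition gen_hadamard_code :: "nat \<Rightarrow> 'f::{field,finite} vec set \<Rightarrow> bool" where
  "gen_hadamard_code v C \<longleftrightarrow> (\<exists>H. GH v H \<and> C = C_code H)"


section \<open>Full propelinear codes\<close>

definition perm_vec :: "(nat \<Rightarrow> nat) \<Rightarrow> 'f vec \<Rightarrow> 'f vec" where
  "perm_vec p y = vec (dim_vec y) (\<lambda>i. y $ (inv_into UNIV p i))"

definition star :: "('f::plus vec \<Rightarrow> nat \<Rightarrow> nat) \<Rightarrow> 'f vec \<Rightarrow> 'f vec \<Rightarrow> 'f vec" where
  "star \<pi> x y = x + perm_vec (\<pi> x) y"

definition full_propelinear ::
  "nat \<Rightarrow> 'f::{field,finite} vec set \<Rightarrow> ('f vec \<Rightarrow> nat \<Rightarrow> nat) \<Rightarrow> bool" where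
  "full_propelinear n C \<pi> \<longleftrightarrow>
     C \<subseteq> carrier_vec n \<and> 0\<^sub>v n \<in> C \<and>
     (\<forall>x\<in>C. \<pi> x permutes {..<n}) \<and>
     (\<forall>x\<in>C. star \<pi> x ` C = C) \<and>
     (\<forall>x\<in>C. \<forall>y\<in>C. \<pi> (star \<pi> x y) = \<pi> x \<circ> \<pi> y) \<and>
     (\<forall>x\<in>C. x \<notin> {\<alpha> \<cdot>\<^sub>v all_one_vec n | \<alpha>. True} \<longrightarrow> (\<forall>i<n. \<pi> x i \<noteq> i)) \<and>
     (\<forall>x\<in>C. x \<in> {\<alpha> \<cdot>\<^sub>v all_one_vec n | \<alpha>. True} \<longrightarrow> \<pi> x = id)"

definition star_group ::
  "nat \<Rightarrow> 'f::{field,finite} vec set \<Rightarrow> ('f vec \<Rightarrow> nat \<Rightarrow> nat) \<Rightarrow> 'f vec monoid" where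
  "star_group n C \<pi> = \<lparr>carrier = C, mult = star \<pi>, one = 0\<^sub>v n\<rparr>"

text \<open>\<open>GHFP n C \<pi>\<close>: the code \<open>C\<close> of length \<open>n\<close>, with the structure \<open>star \<pi>\<close>, is a GHFP-code.\<close>

definition GHFP ::
  "nat \<Rightarrow> 'f::{field,finite} vec set \<Rightarrow> ('f vec \<Rightarrow> nat \<Rightarrow> nat) \<Rightarrow> bool" where
  "GHFP n C \<pi> \<longleftrightarrow> gen_hadamard_code n C \<and> full_propelinear n C \<pi>"

definition GHFP_code :: "nat \<Rightarrow> 'f::{field,finite} vec set \<Rightarrow> bool" where
  "GHFP_code n C \<longleftrightarrow> (\<exists>\<pi>. GHFP n C \<pi>)"


section \<open>Cocycles\<close>

definition cocycle :: "'g monoid \<Rightarrow> 'k monoid \<Rightarrow> ('g \<Rightarrow> 'g \<Rightarrow> 'k) \<Rightarrow> bool" where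
  "cocycle G K \<psi> \<longleftrightarrow>
     group G \<and> finite (carrier G) \<and>
     (\<forall>g\<in>carrier G. \<forall>h\<in>carrier G. \<psi> g h \<in> carrier K) \<and>
     (\<forall>g\<in>carrier G. \<forall>h\<in>carrier G. \<forall>k\<in>carrier G.
        \<psi> g h \<otimes>\<^bsub>K\<^esub> \<psi> (g \<otimes>\<^bsub>G\<^esub> h) k = \<psi> g (h \<otimes>\<^bsub>G\<^esub> k) \<otimes>\<^bsub>K\<^esub> \<psi> h k) \<and>
     (\<forall>g\<in>carrier G. \<psi> g \<one>\<^bsub>G\<^esub> = \<one>\<^bsub>K\<^esub> \<and> \<psi> \<one>\<^bsub>G\<^esub> g = \<one>\<^bsub>K\<^esub>)"

definition extension_group ::
  "'g monoid \<Rightarrow> 'k monoid \<Rightarrow> ('g \<Rightarrow> 'g \<Rightarrow> 'k) \<Rightarrow> ('k \<times> 'g) monoid" where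
  "extension_group G K \<psi> =
     \<lparr>carrier = carrier K \<times> carrier G,
      mult = (\<lambda>(u, g) (v, h). (u \<otimes>\<^bsub>K\<^esub> v \<otimes>\<^bsub>K\<^esub> \<psi> g h, g \<otimes>\<^bsub>G\<^esub> h)),
      one = (\<one>\<^bsub>K\<^esub>, \<one>\<^bsub>G\<^esub>)\<rparr>"

text \<open>Rows and columns may be indexed by \<open>G\<close> through different bijections.\<close>

definition cocyclic_mat :: "'g monoid \<Rightarrow> ('g \<Rightarrow> 'g \<Rightarrow> 'k) \<Rightarrow> 'k mat \<Rightarrow> bool" where
  "cocyclic_mat G \<psi> M \<longleftrightarrow>
     (\<exists>r c. bij_betw r {..<dim_row M} (carrier G) \<and> bij_betw c {..<dim_col M} (carrier G) \<and>
        (\<forall>i<dim_row M. \<forall>j<dim_col M. M $$ (i,j) = \<psi> (r i) (c j)))"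


section \<open>Automorphisms\<close>

text \<open>The \<open>q \<times> q\<close> block matrix with blocks \<open>k i \<otimes> k j \<otimes> M\<close>, where \<open>k\<close> enumerates \<open>K\<close>.\<close>

definition expanded_mat :: "'k monoid \<Rightarrow> nat \<Rightarrow> (nat \<Rightarrow> 'k) \<Rightarrow> 'k mat \<Rightarrow> 'k mat" where
  "expanded_mat K q k M =
     mat (q * dim_row M) (q * dim_col M)
       (\<lambda>(a, b). k (a div dim_row M) \<otimes>\<^bsub>K\<^esub> k (b div dim_col M) \<otimes>\<^bsub>K\<^esub>
                 M $$ (a mod dim_row M, b mod dim_col M))"

definition permutation_mat :: "nat \<Rightarrow> int mat \<Rightarrow> bool" where
  "permutation_mat n P \<longleftrightarrow> P \<in> carrier_mat n n \<and>
     (\<forall>i<n. \<forall>j<n. P $$ (i,j) \<in> {0, 1}) \<and>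
     (\<forall>i<n. \<exists>!j. j < n \<and> P $$ (i,j) = 1) \<and>
     (\<forall>j<n. \<exists>!i. i < n \<and> P $$ (i,j) = 1)"

text \<open>
  \<open>P A Q\<^sup>T\<close> for permutation matrices \<open>P\<close>, \<open>Q\<close> and a matrix \<open>A\<close> whose entries lie in a mere group,
  so that the library product is not available: the entry \<open>\<Sum>\<^sub>k\<^sub>,\<^sub>l P\<^sub>i\<^sub>k A\<^sub>k\<^sub>l Q\<^sub>j\<^sub>l\<close> has a single non-zero
  summand, that with \<open>P\<^sub>i\<^sub>k = 1 = Q\<^sub>j\<^sub>l\<close>.
\<close>

definition perm_mult_mat :: "int mat \<Rightarrow> 'k mat \<Rightarrow> int mat \<Rightarrow> 'k mat" where
  "perm_mult_mat P A Q =
     mat (dim_row A) (dim_col A)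
       (\<lambda>(i, j). A $$ (THE k. k < dim_row A \<and> P $$ (i,k) = 1,
                       THE l. l < dim_col A \<and> Q $$ (j,l) = 1))"

definition PAut :: "'k mat \<Rightarrow> (int mat \<times> int mat) monoid" where
  "PAut A =
     \<lparr>carrier = {(P, Q). permutation_mat (dim_row A) P \<and> permutation_mat (dim_col A) Q \<and>
                         perm_mult_mat P A Q = A},
      mult = (\<lambda>(P, Q) (P', Q'). (P * P', Q * Q')),
      one = (1\<^sub>m (dim_row A), 1\<^sub>m (dim_col A))\<rparr>"

text \<open>
  \<open>(P, Q)\<close> moves row \<open>k\<close> of \<open>A\<close> to position \<open>i\<close> iff \<open>P\<^sub>i\<^sub>k = 1\<close>, and column \<open>l\<close> to position \<open>j\<close>
  iff \<open>Q\<^sub>j\<^sub>l = 1\<close>; an action is regular iff any point is moved to any other by exactly one group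
  element.
\<close>

definition regular_subgroup :: "(int mat \<times> int mat) set \<Rightarrow> 'k mat \<Rightarrow> bool" where
  "regular_subgroup R A \<longleftrightarrow> subgroup R (PAut A) \<and>
     (\<forall>k<dim_row A. \<forall>i<dim_row A. \<exists>!x. x \<in> R \<and> fst x $$ (i,k) = 1) \<and>
     (\<forall>l<dim_col A. \<forall>j<dim_col A. \<exists>!x. x \<in> R \<and> snd x $$ (j,l) = 1)"

end

theory Submission
  imports Defs
begin

text \<open>
  Attach to \<open>(u, g) \<in> E\<^sub>\<psi>\<close> the codeword \<open>row g + \<phi>\<^sup>-\<^sup>1(u) \<one>\<close>. The cocycle identity says exactly that
  this bijection \<open>E\<^sub>\<psi> \<rightarrow> C\<^sub>H\<close> reverses products, where the codeword of \<open>(u, g)\<close> permutes the coordinates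
  (indexed by the group) by \<open>j \<mapsto> g\<^sup>-\<^sup>1 j\<close>; composing with inversion gives an isomorphism. Since every
  propelinear structure arises in this way from the central extension of \<open>C\<^sub>H\<close> by its scalar
  codewords, cocycles and full propelinear structures correspond. The regular subgroup
  comes from the fact that the expanded matrix has the \<open>K\<close>-component of \<open>e f\<close> in position
  \<open>(e, f) \<in> E\<^sub>\<psi> \<times> E\<^sub>\<psi>\<close>, hence is preserved by \<open>(e, f) \<mapsto> (e x, x\<^sup>-\<^sup>1 f)\<close>.
\<close>

section \<open>Permutation matrices of index maps\<close>

text \<open>The orientation matches \<open>perm_mult_mat\<close>: row \<open>f i\<close> is the one
  that is moved to position \<open>i\<close>.\<close>

definition map_pmat :: "nat \<Rightarrow> (nat \<Rightarrow> nat) \<Rightarrow> int mat" where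
  "map_pmat n f = mat n n (\<lambda>(i, j). if j = f i then 1 else 0)"

lemma map_pmat_carrier [simp]: "map_pmat n f \<in> carrier_mat n n"
  by (simp add: map_pmat_def)

lemma map_pmat_eq_1_iff: "i < n \<Longrightarrow> j < n \<Longrightarrow> map_pmat n f $$ (i, j) = 1 \<longleftrightarrow> j = f i"
  by (simp add: map_pmat_def)

text \<open>Row \<open>i\<close> of the product first selects \<open>f i\<close> and then
  \<open>g (f i)\<close>, hence the reversed order. Families of maps that reverse composition
  thereby become homomorphisms into matrices.\<close>

lemma map_pmat_mult:
  assumes "\<And>i. i < n \<Longrightarrow> f i < n"
  shows "map_pmat n f * map_pmat n g = map_pmat n (g \<circ> f)"
proof (rule eq_matI)
  fix i j assume "i < dim_row (map_pmat n (g \<circ> f))" "j < dim_col (map_pmat n (g \<circ> f))"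
  then have ij: "i < n" "j < n" by (auto simp: map_pmat_def)
  have "(map_pmat n f * map_pmat n g) $$ (i, j) =
      (\<Sum>m = 0..<n. (if m = f i then 1 else 0) * (if j = g m then 1 else 0 :: int))"
    using ij by (simp add: map_pmat_def scalar_prod_def)
  also have "\<dots> = (\<Sum>m = 0..<n. if m = f i then (if j = g (f i) then 1 else 0) else 0)"
    by (rule sum.cong) auto
  also have "\<dots> = (if j = g (f i) then 1 else 0)"
    using assms[OF ij(1)] by simp
  finally show "(map_pmat n f * map_pmat n g) $$ (i, j) = map_pmat n (g \<circ> f) $$ (i, j)"
    using ij by (simp add: map_pmat_def)
qed (auto simp: map_pmat_def)

lemma permutation_mat_map_pmat:
  assumes f: "bij_betw f {..<n} {..<n}"
  shows "permutation_mat n (map_pmat n f)"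
  unfolding permutation_mat_def
proof (intro conjI allI impI)
  fix i assume i: "i < n"
  have fi: "f i < n" using f i by (auto dest: bij_betwE)
  show "\<exists>!j. j < n \<and> map_pmat n f $$ (i, j) = 1"
    using i fi by (auto simp: map_pmat_eq_1_iff)
next
  fix j assume j: "j < n"
  then have "j \<in> f ` {..<n}" using f by (simp add: bij_betw_def)
  then obtain i where i: "i < n" "j = f i" by auto
  show "\<exists>!i. i < n \<and> map_pmat n f $$ (i, j) = 1"
    using i j f by (intro ex1I[of _ i]) (auto simp: map_pmat_eq_1_iff bij_betw_def inj_on_def)
qed (auto simp: map_pmat_def)

lemma perm_mult_mat_map_pmat:
  assumes "A \<in> carrier_mat n n" "\<And>i. i < n \<Longrightarrow> f i < n" "\<And>i. i < n \<Longrightarrow> g i < n"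
  shows "perm_mult_mat (map_pmat n f) A (map_pmat n g) = mat n n (\<lambda>(i, j). A $$ (f i, g j))"
proof -
  have "(THE m. m < n \<and> map_pmat n h $$ (i, m) = 1) = h i" if "i < n" "h i < n" for h i
    using that by (intro the_equality) (auto simp: map_pmat_eq_1_iff)
  then show ?thesis
    using assms by (auto simp: perm_mult_mat_def intro!: eq_matI)
qed

section \<open>Regular subgroups from group-developed matrices\<close>

text \<open>The usual argument z = z (x y) = (z x) y = y, carried out with matrices of fixed size,
  so that inverses in \<open>PAut A\<close> can be computed without first showing it to be a
  group.\<close>

lemma inv_PAut_eqI:
  assumes A: "A \<in> carrier_mat n n"
    and y: "y \<in> carrier (PAut A)"
    and xy: "x \<otimes>\<^bsub>PAut A\<^esub> y = \<one>\<^bsub>PAut A\<^esub>" "y \<otimes>\<^bsub>PAut A\<^esub> x = \<one>\<^bsub>PAut A\<^esub>"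
    and x: "x \<in> carrier (PAut A)"
  shows "inv\<^bsub>PAut A\<^esub> x = y"
  unfolding m_inv_def
proof (rule the_equality)
  fix z assume z: "z \<in> carrier (PAut A) \<and> x \<otimes>\<^bsub>PAut A\<^esub> z = \<one>\<^bsub>PAut A\<^esub> \<and>
    z \<otimes>\<^bsub>PAut A\<^esub> x = \<one>\<^bsub>PAut A\<^esub>"
  obtain x1 x2 y1 y2 z1 z2 where [simp]: "x = (x1, x2)" "y = (y1, y2)" "z = (z1, z2)"
    by (cases x, cases y, cases z) auto
  have c: "x1 \<in> carrier_mat n n" "x2 \<in> carrier_mat n n" "y1 \<in> carrier_mat n n"
    "y2 \<in> carrier_mat n n" "z1 \<in> carrier_mat n n" "z2 \<in> carrier_mat n n"
    using A x y z by (auto simp: PAut_def permutation_mat_def)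
  have e: "x1 * y1 = 1\<^sub>m n" "x2 * y2 = 1\<^sub>m n" "z1 * x1 = 1\<^sub>m n" "z2 * x2 = 1\<^sub>m n"
    using xy z A by (auto simp: PAut_def)
  have "z1 = z1 * (x1 * y1)" "z2 = z2 * (x2 * y2)"
    using c e by auto
  moreover have "z1 * (x1 * y1) = (z1 * x1) * y1" "z2 * (x2 * y2) = (z2 * x2) * y2"
    using c by (auto simp: assoc_mult_mat)
  ultimately show "z = y" using c e by auto
qed (use assms in auto)

text \<open>Translations of a group are regular, and the pairs of translations used here leave the
  product of a row label and a column label unchanged. Rows and columns carry separate labellings
  because \<open>cocyclic_mat\<close> allows two indexings.\<close>

lemma regular_subgroup_of_group_developed:
  fixes E :: "'e monoid" and A :: "'k mat"
  assumes E: "group E" and A: "A \<in> carrier_mat n n"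
    and \<rho>: "bij_betw \<rho> {..<n} (carrier E)" and \<kappa>: "bij_betw \<kappa> {..<n} (carrier E)"
    and entry: "\<And>a b. a < n \<Longrightarrow> b < n \<Longrightarrow> A $$ (a, b) = \<eta> (\<rho> a \<otimes>\<^bsub>E\<^esub> \<kappa> b)"
  shows "\<exists>R. regular_subgroup R A \<and> E \<cong> PAut A \<lparr>carrier := R\<rparr>"
proof -
  interpret E: group E by fact
  define \<rho>' where "\<rho>' = inv_into {..<n} \<rho>"
  define \<kappa>' where "\<kappa>' = inv_into {..<n} \<kappa>"
  have \<rho>1: "\<rho> a \<in> carrier E" "\<rho>' (\<rho> a) = a" if "a < n" for a
    using \<rho> that by (auto simp: \<rho>'_def bij_betw_def)
  have \<rho>2: "\<rho>' e < n" "\<rho> (\<rho>' e) = e" if "e \<in> carrier E" for e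
    using \<rho> that inv_into_into[of e \<rho> "{..<n}"]
    by (auto simp: \<rho>'_def bij_betw_def f_inv_into_f)
  have \<kappa>1: "\<kappa> a \<in> carrier E" "\<kappa>' (\<kappa> a) = a" if "a < n" for a
    using \<kappa> that by (auto simp: \<kappa>'_def bij_betw_def)
  have \<kappa>2: "\<kappa>' e < n" "\<kappa> (\<kappa>' e) = e" if "e \<in> carrier E" for e
    using \<kappa> that inv_into_into[of e \<kappa> "{..<n}"]
    by (auto simp: \<kappa>'_def bij_betw_def f_inv_into_f)
  \<comment> \<open>Right translation by \<open>x\<close> on row labels, and left translation by the
    inverse of \<open>x\<close> on column labels, both carried over to indices.\<close>
  define p where "p x a = \<rho>' (\<rho> a \<otimes>\<^bsub>E\<^esub> x)" for x a
  define s where "s x b = \<kappa>' (inv\<^bsub>E\<^esub> x \<otimes>\<^bsub>E\<^esub> \<kappa> b)" for x b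
  have p_lt: "p x a < n" if "x \<in> carrier E" "a < n" for x a
    using that by (simp add: p_def \<rho>1 \<rho>2)
  have s_lt: "s x a < n" if "x \<in> carrier E" "a < n" for x a
    using that by (simp add: s_def \<kappa>1 \<kappa>2)
  have p_one: "p \<one>\<^bsub>E\<^esub> a = a" if "a < n" for a using that by (simp add: p_def \<rho>1)
  have s_one: "s \<one>\<^bsub>E\<^esub> a = a" if "a < n" for a using that by (simp add: s_def \<kappa>1)
  \<comment> \<open>\<open>p\<close> and \<open>s\<close> both reverse composition, which
    \<open>map_pmat_mult\<close> reverses once more; so \<open>\<Theta>\<close> is a
    homomorphism.\<close>
  have p_mult: "p (x \<otimes>\<^bsub>E\<^esub> y) a = p y (p x a)"
    if "x \<in> carrier E" "y \<in> carrier E" "a < n" for x y a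
    using that by (simp add: p_def \<rho>1 \<rho>2 E.m_assoc)
  have s_mult: "s (x \<otimes>\<^bsub>E\<^esub> y) a = s y (s x a)"
    if "x \<in> carrier E" "y \<in> carrier E" "a < n" for x y a
    using that by (simp add: s_def \<kappa>1 \<kappa>2 E.m_assoc E.inv_mult_group)
  have p_bij: "bij_betw (p x) {..<n} {..<n}" if x: "x \<in> carrier E" for x
    by (rule bij_betw_byWitness[where f' = "p (inv\<^bsub>E\<^esub> x)"])
      (use x in \<open>auto simp: p_lt p_one simp flip: p_mult\<close>)
  have s_bij: "bij_betw (s x) {..<n} {..<n}" if x: "x \<in> carrier E" for x
    by (rule bij_betw_byWitness[where f' = "s (inv\<^bsub>E\<^esub> x)"])
      (use x in \<open>auto simp: s_lt s_one simp flip: s_mult\<close>)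
  define \<Theta> where "\<Theta> x = (map_pmat n (p x), map_pmat n (s x))" for x
  have pmat_cong: "map_pmat n f = map_pmat n g" if "\<And>a. a < n \<Longrightarrow> f a = g a" for f g
    using that by (auto simp: map_pmat_def intro!: eq_matI)
  have \<Theta>_carrier: "\<Theta> x \<in> carrier (PAut A)" if x: "x \<in> carrier E" for x
  proof -
    have "A $$ (p x a, s x b) = A $$ (a, b)" if ab: "a < n" "b < n" for a b
    proof -
      have "x \<otimes>\<^bsub>E\<^esub> (inv\<^bsub>E\<^esub> x \<otimes>\<^bsub>E\<^esub> \<kappa> b) = \<kappa> b"
        using x \<kappa>1(1)[OF ab(2)] by (simp flip: E.m_assoc)
      then have "\<rho> a \<otimes>\<^bsub>E\<^esub> x \<otimes>\<^bsub>E\<^esub> (inv\<^bsub>E\<^esub> x \<otimes>\<^bsub>E\<^esub> \<kappa> b) = \<rho> a \<otimes>\<^bsub>E\<^esub> \<kappa> b"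
        using x \<rho>1(1)[OF ab(1)] \<kappa>1(1)[OF ab(2)] by (simp add: E.m_assoc)
      then show ?thesis
        using x ab by (simp add: entry p_lt s_lt) (simp add: p_def s_def \<rho>1 \<rho>2 \<kappa>1 \<kappa>2)
    qed
    then have "perm_mult_mat (map_pmat n (p x)) A (map_pmat n (s x)) = A"
      using A x by (subst perm_mult_mat_map_pmat[OF A]) (auto simp: p_lt s_lt intro!: eq_matI)
    then show ?thesis
      using A x by (simp add: \<Theta>_def PAut_def permutation_mat_map_pmat p_bij s_bij)
  qed
  have \<Theta>_mult: "\<Theta> x \<otimes>\<^bsub>PAut A\<^esub> \<Theta> y = \<Theta> (x \<otimes>\<^bsub>E\<^esub> y)"
    if "x \<in> carrier E" "y \<in> carrier E" for x y
    using that by (auto simp: \<Theta>_def PAut_def map_pmat_mult p_lt s_lt p_mult s_mult intro!: pmat_cong)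
  have \<Theta>_one: "\<Theta> \<one>\<^bsub>E\<^esub> = \<one>\<^bsub>PAut A\<^esub>"
    using A by (auto simp: \<Theta>_def PAut_def map_pmat_def p_one s_one intro!: eq_matI)
  have inv_\<Theta>: "inv\<^bsub>PAut A\<^esub> (\<Theta> x) = \<Theta> (inv\<^bsub>E\<^esub> x)" if "x \<in> carrier E" for x
    using that by (intro inv_PAut_eqI[OF A]) (auto simp: \<Theta>_carrier \<Theta>_mult \<Theta>_one)
  define R where "R = \<Theta> ` carrier E"
  have sub: "subgroup R (PAut A)"
  proof
    show "\<one>\<^bsub>PAut A\<^esub> \<in> R" unfolding R_def \<Theta>_one[symmetric] by blast
  qed (auto simp: R_def \<Theta>_carrier \<Theta>_mult inv_\<Theta>)
  \<comment> \<open>Regularity: the equation between labels can be solved for \<open>x\<close>, so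
    exactly one translation relates two given row indices; \<open>s_eq\<close> does the same for
    columns.\<close>
  have p_eq: "a = p x b \<longleftrightarrow> x = inv\<^bsub>E\<^esub> (\<rho> b) \<otimes>\<^bsub>E\<^esub> \<rho> a"
    if "x \<in> carrier E" "a < n" "b < n" for x a b
  proof -
    have "a = p x b \<longleftrightarrow> \<rho> a = \<rho> b \<otimes>\<^bsub>E\<^esub> x"
      using that \<rho>1 \<rho>2 unfolding p_def by (metis E.m_closed)
    also have "\<dots> \<longleftrightarrow> x = inv\<^bsub>E\<^esub> (\<rho> b) \<otimes>\<^bsub>E\<^esub> \<rho> a"
      using that \<rho>1 by (metis E.inv_closed E.inv_solve_left)
    finally show ?thesis .
  qed
  have s_eq: "a = s x b \<longleftrightarrow> x = \<kappa> b \<otimes>\<^bsub>E\<^esub> inv\<^bsub>E\<^esub> (\<kappa> a)"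
    if "x \<in> carrier E" "a < n" "b < n" for x a b
  proof -
    have "a = s x b \<longleftrightarrow> \<kappa> a = inv\<^bsub>E\<^esub> x \<otimes>\<^bsub>E\<^esub> \<kappa> b"
      using that \<kappa>1 \<kappa>2 unfolding s_def by (metis E.m_closed E.inv_closed)
    also have "\<dots> \<longleftrightarrow> x \<otimes>\<^bsub>E\<^esub> \<kappa> a = \<kappa> b"
      using that \<kappa>1 by (metis E.inv_closed E.inv_solve_left E.m_closed)
    also have "\<dots> \<longleftrightarrow> x = \<kappa> b \<otimes>\<^bsub>E\<^esub> inv\<^bsub>E\<^esub> (\<kappa> a)"
      using that \<kappa>1 by (metis E.inv_closed E.inv_solve_right E.m_closed)
    finally show ?thesis .
  qed
  have reg1: "\<exists>!z. z \<in> R \<and> fst z $$ (i, l) = 1" if "i < n" "l < n" for i l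
  proof -
    have "inv\<^bsub>E\<^esub> (\<rho> i) \<otimes>\<^bsub>E\<^esub> \<rho> l \<in> carrier E" using that \<rho>1 by simp
    then show ?thesis using that
      by (intro ex1I[of _ "\<Theta> (inv\<^bsub>E\<^esub> (\<rho> i) \<otimes>\<^bsub>E\<^esub> \<rho> l)"])
        (auto simp: R_def \<Theta>_def map_pmat_eq_1_iff p_eq)
  qed
  have reg2: "\<exists>!z. z \<in> R \<and> snd z $$ (i, l) = 1" if "i < n" "l < n" for i l
  proof -
    have "\<kappa> i \<otimes>\<^bsub>E\<^esub> inv\<^bsub>E\<^esub> (\<kappa> l) \<in> carrier E" using that \<kappa>1 by simp
    then show ?thesis using that
      by (intro ex1I[of _ "\<Theta> (\<kappa> i \<otimes>\<^bsub>E\<^esub> inv\<^bsub>E\<^esub> (\<kappa> l))"])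
        (auto simp: R_def \<Theta>_def map_pmat_eq_1_iff s_eq)
  qed
  have reg: "regular_subgroup R A"
    using sub reg1 reg2 A unfolding regular_subgroup_def by auto
  have inj: "inj_on \<Theta> (carrier E)"
  proof (rule inj_onI)
    fix x y assume xy: "x \<in> carrier E" "y \<in> carrier E" "\<Theta> x = \<Theta> y"
    \<comment> \<open>The row labelled by the identity: right translation by \<open>x\<close> takes
      it to the row labelled \<open>x\<close>, so \<open>\<Theta> x\<close> determines
      \<open>x\<close>.\<close>
    let ?a = "\<rho>' \<one>\<^bsub>E\<^esub>"
    have a: "?a < n" by (simp add: \<rho>2)
    have "map_pmat n (p x) $$ (?a, p x ?a) = map_pmat n (p y) $$ (?a, p x ?a)"
      using xy by (simp add: \<Theta>_def)
    then have "p x ?a = p y ?a"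
      using a p_lt[OF xy(1) a] by (simp add: map_pmat_def split: if_splits)
    then have "\<rho> (\<rho>' x) = \<rho> (\<rho>' y)" using xy by (simp add: p_def \<rho>2)
    then show "x = y" using xy by (simp add: \<rho>2)
  qed
  have "\<Theta> \<in> iso E (PAut A \<lparr>carrier := R\<rparr>)"
    using inj by (auto simp: iso_def hom_def bij_betw_def R_def \<Theta>_mult)
  then show ?thesis using reg by (auto simp: is_iso_def)
qed

section \<open>Extension groups and expanded matrices\<close>

text \<open>As \<open>K\<close> is commutative, the \<open>K\<close>-components of a triple product
  can be collected; the two bracketings then agree by the cocycle identity.\<close>

lemma group_extension_group:
  assumes K: "comm_group K" and co: "cocycle G K \<psi>"
  shows "group (extension_group G K \<psi>)"
proof -
  interpret K: comm_group K by fact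
  interpret G: group G using co by (simp add: cocycle_def)
  have \<psi>_closed [simp]: "\<psi> g h \<in> carrier K" if "g \<in> carrier G" "h \<in> carrier G" for g h
    using co that by (simp add: cocycle_def)
  have \<psi>_one [simp]: "\<psi> g \<one>\<^bsub>G\<^esub> = \<one>\<^bsub>K\<^esub>" "\<psi> \<one>\<^bsub>G\<^esub> g = \<one>\<^bsub>K\<^esub>" if "g \<in> carrier G" for g
    using co that by (simp_all add: cocycle_def)
  have \<psi>_co: "\<psi> g h \<otimes>\<^bsub>K\<^esub> \<psi> (g \<otimes>\<^bsub>G\<^esub> h) l = \<psi> g (h \<otimes>\<^bsub>G\<^esub> l) \<otimes>\<^bsub>K\<^esub> \<psi> h l"
    if "g \<in> carrier G" "h \<in> carrier G" "l \<in> carrier G" for g h l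
    using co that by (simp add: cocycle_def)
  show ?thesis
  proof (rule groupI)
    fix x y z assume "x \<in> carrier (extension_group G K \<psi>)" "y \<in> carrier (extension_group G K \<psi>)"
      "z \<in> carrier (extension_group G K \<psi>)"
    then obtain u g w h t l where [simp]: "x = (u, g)" "y = (w, h)" "z = (t, l)"
      and c [simp]: "u \<in> carrier K" "w \<in> carrier K" "t \<in> carrier K"
        "g \<in> carrier G" "h \<in> carrier G" "l \<in> carrier G"
      by (auto simp: extension_group_def)
    have "u \<otimes>\<^bsub>K\<^esub> w \<otimes>\<^bsub>K\<^esub> \<psi> g h \<otimes>\<^bsub>K\<^esub> t \<otimes>\<^bsub>K\<^esub> \<psi> (g \<otimes>\<^bsub>G\<^esub> h) l =
        (u \<otimes>\<^bsub>K\<^esub> w \<otimes>\<^bsub>K\<^esub> t) \<otimes>\<^bsub>K\<^esub> (\<psi> g h \<otimes>\<^bsub>K\<^esub> \<psi> (g \<otimes>\<^bsub>G\<^esub> h) l)"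
      by (simp add: K.m_ac)
    also have "\<dots> = u \<otimes>\<^bsub>K\<^esub> (w \<otimes>\<^bsub>K\<^esub> t \<otimes>\<^bsub>K\<^esub> \<psi> h l) \<otimes>\<^bsub>K\<^esub> \<psi> g (h \<otimes>\<^bsub>G\<^esub> l)"
      by (simp add: \<psi>_co K.m_ac)
    finally show "x \<otimes>\<^bsub>extension_group G K \<psi>\<^esub> y \<otimes>\<^bsub>extension_group G K \<psi>\<^esub> z =
        x \<otimes>\<^bsub>extension_group G K \<psi>\<^esub> (y \<otimes>\<^bsub>extension_group G K \<psi>\<^esub> z)"
      by (simp add: extension_group_def G.m_assoc)
  next
    fix x assume "x \<in> carrier (extension_group G K \<psi>)"
    then obtain u g where [simp]: "x = (u, g)"
      and c [simp]: "u \<in> carrier K" "g \<in> carrier G"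
      by (auto simp: extension_group_def)
    \<comment> \<open>The left inverse of (u, g) has second component g^-1; its first component t
      solves t u \<psi>(g^-1, g) = 1.\<close>
    have "inv\<^bsub>K\<^esub> (u \<otimes>\<^bsub>K\<^esub> \<psi> (inv\<^bsub>G\<^esub> g) g) \<otimes>\<^bsub>K\<^esub> u \<otimes>\<^bsub>K\<^esub> \<psi> (inv\<^bsub>G\<^esub> g) g = \<one>\<^bsub>K\<^esub>"
      by (subst K.m_assoc) auto
    then show "\<exists>y\<in>carrier (extension_group G K \<psi>).
        y \<otimes>\<^bsub>extension_group G K \<psi>\<^esub> x = \<one>\<^bsub>extension_group G K \<psi>\<^esub>"
      by (intro bexI[of _ "(inv\<^bsub>K\<^esub> (u \<otimes>\<^bsub>K\<^esub> \<psi> (inv\<^bsub>G\<^esub> g) g), inv\<^bsub>G\<^esub> g)"])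
        (auto simp: extension_group_def)
  qed (auto simp: extension_group_def)
qed

text \<open>An index of a block matrix splits into a block number and a position inside the block.
  With \<open>k\<close> on the blocks and an indexing by \<open>G\<close> inside them, rows and
  columns become labelled by elements of the extension group.\<close>

lemma bij_betw_div_mod:
  assumes k: "bij_betw k {..<q} A" and r: "bij_betw r {..<v} B" and v: "0 < (v::nat)"
  shows "bij_betw (\<lambda>a. (k (a div v), r (a mod v))) {..<q * v} (A \<times> B)"
proof -
  have "bij_betw (\<lambda>a. (a div v, a mod v)) {..<q * v} ({..<q} \<times> {..<v})"
  proof (rule bij_betw_byWitness[where f' = "\<lambda>(a, i). a * v + i"])
    have "a * v + i < q * v" if "a < q" "i < v" for a i
    proof -
      have "a * v + i < Suc a * v" using that by simp
      also have "\<dots> \<le> q * v" using that by (intro mult_right_mono) auto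
      finally show ?thesis .
    qed
    then show "(\<lambda>(a, i). a * v + i) ` ({..<q} \<times> {..<v}) \<subseteq> {..<q * v}" by auto
  qed (use v in \<open>auto simp: less_mult_imp_div_less\<close>)
  moreover have "bij_betw (map_prod k r) ({..<q} \<times> {..<v}) (A \<times> B)"
    using k r by (rule bij_betw_map_prod)
  ultimately have "bij_betw (map_prod k r \<circ> (\<lambda>a. (a div v, a mod v))) {..<q * v} (A \<times> B)"
    by (rule bij_betw_trans)
  then show ?thesis by (simp add: o_def)
qed

text \<open>At labels (u, g) and (w, h) the expanded matrix has entry u w \<psi>(g, h), the first
  component of the product (u, g)(w, h). Hence it is group-developed over the extension group, with
  \<open>\<eta> = fst\<close>.\<close>

lemma regular_subgroup_of_cocyclic:
  assumes K: "comm_group K" and k: "bij_betw k {..<q} (carrier K)"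
    and co: "cocycle G K \<psi>" and M: "M \<in> carrier_mat v v" "0 < v" and cm: "cocyclic_mat G \<psi> M"
  shows "\<exists>R. regular_subgroup R (expanded_mat K q k M) \<and>
    extension_group G K \<psi> \<cong> PAut (expanded_mat K q k M) \<lparr>carrier := R\<rparr>"
proof -
  obtain r c where r: "bij_betw r {..<v} (carrier G)" and c: "bij_betw c {..<v} (carrier G)"
    and rc: "\<And>i j. i < v \<Longrightarrow> j < v \<Longrightarrow> M $$ (i, j) = \<psi> (r i) (c j)"
    using cm M unfolding cocyclic_mat_def by auto
  have b: "bij_betw (\<lambda>a. (k (a div v), s (a mod v))) {..<q * v} (carrier (extension_group G K \<psi>))"
    if "bij_betw s {..<v} (carrier G)" for s
    using bij_betw_div_mod[OF k that M(2)] by (simp add: extension_group_def)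
  show ?thesis
    by (rule regular_subgroup_of_group_developed[OF group_extension_group[OF K co] _ b[OF r] b[OF c],
          where \<eta> = fst])
      (use M rc in \<open>auto simp: expanded_mat_def extension_group_def\<close>)
qed

section \<open>Isomorphisms and coordinate permutations\<close>

text \<open>Inversion in \<open>E\<close> also reverses products, so \<open>f\<close> composed with
  it preserves them. \<open>S\<close> may be a mere magma, so \<open>star_group\<close> does not
  have to be shown to be a group first.\<close>

lemma anti_iso_imp_is_iso:
  assumes E: "group E" and bij: "bij_betw f (carrier E) (carrier S)"
    and anti: "\<And>x y. x \<in> carrier E \<Longrightarrow> y \<in> carrier E \<Longrightarrow>
      f (x \<otimes>\<^bsub>E\<^esub> y) = f y \<otimes>\<^bsub>S\<^esub> f x"
  shows "E \<cong> S"
proof -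
  interpret group E by fact
  have i: "bij_betw (m_inv E) (carrier E) (carrier E)"
    by (rule bij_betw_byWitness[where f' = "m_inv E"]) auto
  have "bij_betw (f \<circ> m_inv E) (carrier E) (carrier S)"
    using i bij by (rule bij_betw_trans)
  then have "f \<circ> m_inv E \<in> iso E S"
    by (auto simp: iso_def hom_def inv_mult_group anti dest: bij_betwE)
  then show ?thesis by (auto simp: is_iso_def)
qed

text \<open>Commutativity of \<open>K\<close>, on which extension groups rely, is transported from
  addition in the field.\<close>

lemma iso_additive_group_facts:
  fixes K :: "'k monoid" and \<phi> :: "'f::ab_group_add \<Rightarrow> 'k"
  assumes "group K" and \<phi>: "\<phi> \<in> iso additive_group K"
  shows iso_additive_group_add: "\<phi> (a + b) = \<phi> a \<otimes>\<^bsub>K\<^esub> \<phi> b"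
    and iso_additive_group_zero: "\<phi> 0 = \<one>\<^bsub>K\<^esub>"
    and iso_additive_group_bij: "bij_betw \<phi> UNIV (carrier K)"
    and iso_additive_group_comm: "comm_group K"
proof -
  interpret K: group K by fact
  show add: "\<phi> (a + b) = \<phi> a \<otimes>\<^bsub>K\<^esub> \<phi> b" for a b
    using \<phi> by (auto simp: iso_def hom_def additive_group_def)
  show bij: "bij_betw \<phi> UNIV (carrier K)"
    using \<phi> by (auto simp: iso_def additive_group_def)
  then have c: "\<phi> a \<in> carrier K" for a by (auto dest: bij_betwE)
  show "\<phi> 0 = \<one>\<^bsub>K\<^esub>"
    using add[of 0 0] c[of 0] by (simp add: K.l_cancel_one')
  show "comm_group K"
  proof (rule K.group_comm_groupI)
    fix x y assume "x \<in> carrier K" "y \<in> carrier K"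
    then have "x \<in> range \<phi>" "y \<in> range \<phi>" using bij by (simp_all add: bij_betw_def)
    then obtain a b where "x = \<phi> a" "y = \<phi> b" by blast
    then show "x \<otimes>\<^bsub>K\<^esub> y = y \<otimes>\<^bsub>K\<^esub> x" by (metis add add.commute)
  qed
qed

lemma perm_vec_add: "dim_vec x = dim_vec y \<Longrightarrow> p permutes {..<dim_vec x} \<Longrightarrow>
    perm_vec p (x + y) = perm_vec p x + perm_vec p y"
  using permutes_in_image[OF permutes_inv, of p "{..<dim_vec x}"]
  by (intro eq_vecI) (simp_all add: perm_vec_def)

text \<open>Inverting a composition reverses it, which makes \<open>perm_vec\<close> a left action.
  The index range has to be preserved because entries beyond the dimension are unspecified.\<close>

lemma perm_vec_comp:
  assumes p: "p permutes {..<dim_vec x}" and s: "s permutes {..<dim_vec x}"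
  shows "perm_vec (p \<circ> s) x = perm_vec p (perm_vec s x)"
proof (rule eq_vecI)
  fix i assume "i < dim_vec (perm_vec p (perm_vec s x))"
  then have i: "i < dim_vec x" by (simp add: perm_vec_def)
  then have "inv_into UNIV p i < dim_vec x"
    using permutes_in_image[OF permutes_inv[OF p], of i] by simp
  moreover have "inv_into UNIV (p \<circ> s) = inv_into UNIV s \<circ> inv_into UNIV p"
    using permutes_bij[OF p] permutes_bij[OF s] by (rule o_inv_distrib)
  ultimately show "perm_vec (p \<circ> s) x $ i = perm_vec p (perm_vec s x) $ i"
    using i by (simp add: perm_vec_def)
qed (simp add: perm_vec_def)

section \<open>Codewords of a normalized matrix\<close>

text \<open>Coordinates on the code: a row index and a scalar. For normalized \<open>H\<close> the
  scalar is the entry of the codeword at coordinate 0.\<close>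

definition codeword :: "'f::{field,finite} mat \<Rightarrow> nat \<Rightarrow> 'f \<Rightarrow> 'f vec" where
  "codeword H i \<alpha> = vec (dim_col H) (\<lambda>j. H $$ (i, j) + \<alpha>)"

locale normalized_GH =
  fixes H :: "'f::{field,finite} mat" and v :: nat
  assumes GH: "GH v H" and normalized: "normalized_mat H"
begin

lemma H_carrier [simp]: "H \<in> carrier_mat v v" and v_pos [simp]: "0 < v"
  and dim_H [simp]: "dim_row H = v" "dim_col H = v"
  using GH by (auto simp: GH_def)

lemma H_0_left [simp]: "j < v \<Longrightarrow> H $$ (0, j) = 0"
  and H_0_right [simp]: "i < v \<Longrightarrow> H $$ (i, 0) = 0"
  using normalized by (auto simp: normalized_mat_def)

lemma codeword_index [simp]: "j < v \<Longrightarrow> codeword H i \<alpha> $ j = H $$ (i, j) + \<alpha>"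
  and dim_codeword [simp]: "dim_vec (codeword H i \<alpha>) = v"
  by (simp_all add: codeword_def)

lemma C_code_eq: "C_code H = (\<lambda>(i, \<alpha>). codeword H i \<alpha>) ` ({..<v} \<times> UNIV)"
proof -
  have *: "row H i + \<alpha> \<cdot>\<^sub>v all_one_vec v = codeword H i \<alpha>" if "i < v" for i \<alpha>
    using that by (auto simp: all_one_vec_def intro!: eq_vecI)
  have "C_code H = (\<Union>\<alpha>. (\<lambda>i. row H i + \<alpha> \<cdot>\<^sub>v all_one_vec v) ` {..<v})"
    by (simp add: C_code_def F_rows_def rows_def image_image atLeast0LessThan)
  also have "\<dots> = (\<Union>\<alpha>. (\<lambda>i. codeword H i \<alpha>) ` {..<v})"
    by (intro SUP_cong image_cong) (simp_all add: *)
  finally show ?thesis by auto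
qed

lemma codeword_in_C [intro]: "i < v \<Longrightarrow> codeword H i \<alpha> \<in> C_code H"
  by (auto simp: C_code_eq)

lemma in_C_E:
  assumes "x \<in> C_code H"
  obtains i \<alpha> where "i < v" "x = codeword H i \<alpha>"
  using assms by (auto simp: C_code_eq)

text \<open>For distinct rows each of the q > 1 field elements occurs v/q > 0 times as a difference,
  so the differences cannot all agree.\<close>

lemma rows_differ_by_constant:
  assumes "i < v" "j < v" and d: "\<And>l. l < v \<Longrightarrow> H $$ (i, l) - H $$ (j, l) = d"
  shows "i = j"
proof -
  have *: False if "i < j" "j < v" and d: "\<And>l. l < v \<Longrightarrow> H $$ (i, l) - H $$ (j, l) = d" for i j d
  proof -
    have "{# H $$ (i, l) - H $$ (j, l). l \<in># mset_set {..<v} #} = {# d. l \<in># mset_set {..<v} #}"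
      by (rule image_mset_cong) (use d in auto)
    \<comment> \<open>\<open>d + 1\<close> serves as an element other than \<open>d\<close>.\<close>
    then have "count {# H $$ (i, l) - H $$ (j, l). l \<in># mset_set {..<v} #} (d + 1) = 0"
      by (simp add: image_mset_const_eq)
    moreover have "count {# H $$ (i, l) - H $$ (j, l). l \<in># mset_set {..<v} #} (d + 1) =
        v div CARD('f)"
      using GH that unfolding GH_def by blast
    moreover have "CARD('f) dvd v" "0 < v" using GH by (auto simp: GH_def)
    ultimately show False by (auto simp: div_eq_0_iff dest: dvd_imp_le)
  qed
  \<comment> \<open>\<open>GH\<close> compares rows only for i < j; the other order is reduced to it
    by negating \<open>d\<close>.\<close>
  have "H $$ (j, l) - H $$ (i, l) = - d" if "l < v" for l
    using d[OF that] by (auto simp: algebra_simps)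
  then show ?thesis using *[of i j d] *[of j i "- d"] assms by (cases i j rule: linorder_cases) auto
qed

lemma codeword_eq_iff:
  assumes "i < v" "j < v"
  shows "codeword H i \<alpha> = codeword H j \<beta> \<longleftrightarrow> i = j \<and> \<alpha> = \<beta>"
proof
  assume e: "codeword H i \<alpha> = codeword H j \<beta>"
  have *: "H $$ (i, l) - H $$ (j, l) = \<beta> - \<alpha>" if "l < v" for l
    using arg_cong[OF e, of "\<lambda>x. x $ l"] that by (simp add: algebra_simps)
  have "i = j" using assms * by (rule rows_differ_by_constant)
  then show "i = j \<and> \<alpha> = \<beta>" using *[of 0] by simp
qed simp

lemma scaled_one_eq_codeword: "\<alpha> \<cdot>\<^sub>v all_one_vec v = codeword H 0 \<alpha>"
  by (auto simp: all_one_vec_def intro!: eq_vecI)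

lemma zero_eq_codeword: "0\<^sub>v v = codeword H 0 0"
  by (auto intro!: eq_vecI)

text \<open>The zero row of a normalized matrix yields precisely the scalar codewords, so the case
  distinction in condition (iii) becomes one on the row index.\<close>

lemma codeword_constant_iff:
  "i < v \<Longrightarrow> (\<exists>\<beta>. codeword H i \<alpha> = \<beta> \<cdot>\<^sub>v all_one_vec v) \<longleftrightarrow> i = 0"
  by (auto simp: scaled_one_eq_codeword codeword_eq_iff)

lemma C_code_bij: "bij_betw (\<lambda>(i, \<alpha>). codeword H i \<alpha>) ({..<v} \<times> UNIV) (C_code H)"
  by (auto simp: bij_betw_def inj_on_def C_code_eq codeword_eq_iff)

section \<open>From cocycles to full propelinear structures\<close>

lemma GHFP_of_cocyclic:
  assumes K: "group K" and \<phi>: "\<phi> \<in> iso additive_group K"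
    and co: "cocycle G K \<psi>" and cm: "cocyclic_mat G \<psi> (map_mat \<phi> H)"
  shows "\<exists>\<pi>. GHFP v (C_code H) \<pi> \<and> extension_group G K \<psi> \<cong> star_group v (C_code H) \<pi>"
proof -
  note add = iso_additive_group_add[OF K \<phi>] and zero = iso_additive_group_zero[OF K \<phi>]
    and bij = iso_additive_group_bij[OF K \<phi>]
  interpret K: comm_group K by (rule iso_additive_group_comm[OF K \<phi>])
  interpret G: group G using co by (simp add: cocycle_def)
  interpret E: group "extension_group G K \<psi>"
    by (rule group_extension_group) (use co K.comm_group_axioms in auto)
  have \<phi>_closed [simp]: "\<phi> a \<in> carrier K" for a using bij by (auto dest: bij_betwE)
  have \<phi>_inj: "\<phi> a = \<phi> b \<longleftrightarrow> a = b" for a b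
    using bij by (auto simp: bij_betw_def inj_on_def)
  have \<psi>_closed [simp]: "\<psi> g h \<in> carrier K" if "g \<in> carrier G" "h \<in> carrier G" for g h
    using co that by (simp add: cocycle_def)
  have \<psi>_one [simp]: "\<psi> g \<one>\<^bsub>G\<^esub> = \<one>\<^bsub>K\<^esub>" "\<psi> \<one>\<^bsub>G\<^esub> g = \<one>\<^bsub>K\<^esub>" if "g \<in> carrier G" for g
    using co that by (simp_all add: cocycle_def)
  have \<psi>_co: "\<psi> g h \<otimes>\<^bsub>K\<^esub> \<psi> (g \<otimes>\<^bsub>G\<^esub> h) l = \<psi> g (h \<otimes>\<^bsub>G\<^esub> l) \<otimes>\<^bsub>K\<^esub> \<psi> h l"
    if "g \<in> carrier G" "h \<in> carrier G" "l \<in> carrier G" for g h l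
    using co that by (simp add: cocycle_def)
  obtain r c where r: "bij_betw r {..<v} (carrier G)" and c: "bij_betw c {..<v} (carrier G)"
    and rc: "\<And>i j. i < v \<Longrightarrow> j < v \<Longrightarrow> \<phi> (H $$ (i, j)) = \<psi> (r i) (c j)"
    using cm unfolding cocyclic_mat_def by auto
  define r' where "r' = inv_into {..<v} r"
  define c' where "c' = inv_into {..<v} c"
  have r1: "r i \<in> carrier G" "r' (r i) = i" if "i < v" for i
    using r that by (auto simp: r'_def bij_betw_def)
  have r2: "r' g < v" "r (r' g) = g" if "g \<in> carrier G" for g
    using r that inv_into_into[of g r "{..<v}"]
    by (auto simp: r'_def bij_betw_def f_inv_into_f)
  have c1: "c i \<in> carrier G" "c' (c i) = i" if "i < v" for i
    using c that by (auto simp: c'_def bij_betw_def)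
  have c2: "c' g < v" "c (c' g) = g" if "g \<in> carrier G" for g
    using c that inv_into_into[of g c "{..<v}"]
    by (auto simp: c'_def bij_betw_def f_inv_into_f)
  have rc': "\<phi> (H $$ (r' g, j)) = \<psi> g (c j)" if "g \<in> carrier G" "j < v" for g j
    using that by (simp add: rc r2)
  \<comment> \<open>\<psi>(1, h) = 1 makes the row labelled by the identity a zero row, and row 0 is
    one too; distinct rows cannot coincide.\<close>
  have r'_one: "r' \<one>\<^bsub>G\<^esub> = 0"
  proof (rule rows_differ_by_constant[where d = 0])
    fix l assume "l < v"
    then have "\<phi> (H $$ (r' \<one>\<^bsub>G\<^esub>, l)) = \<phi> 0" by (simp add: rc' c1 zero)
    then show "H $$ (r' \<one>\<^bsub>G\<^esub>, l) - H $$ (0, l) = 0" using \<open>l < v\<close> by (simp add: \<phi>_inj)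
  qed (simp_all add: r2)
  have r_0: "r 0 = \<one>\<^bsub>G\<^esub>" using r2(2)[of "\<one>\<^bsub>G\<^esub>"] by (simp add: r'_one)
  have r_eq_one: "r i = \<one>\<^bsub>G\<^esub> \<longleftrightarrow> i = 0" if "i < v" for i
    using r1(2)[OF that] r'_one r_0 by auto
  \<comment> \<open>Left translation by g^-1 on the coordinates as labelled by \<open>c\<close>.
    Indices from \<open>v\<close> on are fixed, as \<open>permutes\<close> demands.\<close>
  define shift where "shift g j = (if j < v then c' (inv\<^bsub>G\<^esub> g \<otimes>\<^bsub>G\<^esub> c j) else j)" for g j
  have shift_mult: "shift (h \<otimes>\<^bsub>G\<^esub> g) = shift g \<circ> shift h"
    if "g \<in> carrier G" "h \<in> carrier G" for g h
    using that by (auto simp: shift_def c1 c2 G.inv_mult_group G.m_assoc)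
  have shift_one: "shift \<one>\<^bsub>G\<^esub> = id" by (auto simp: shift_def c1)
  have shift_inv: "shift (inv\<^bsub>G\<^esub> g) \<circ> shift g = id" "shift g \<circ> shift (inv\<^bsub>G\<^esub> g) = id"
    if "g \<in> carrier G" for g
    using that by (simp_all add: shift_one flip: shift_mult)
  have shift_bij: "bij (shift g)" if "g \<in> carrier G" for g
    using shift_inv[OF that] by (rule o_bij)
  have shift_permutes: "shift g permutes {..<v}" if "g \<in> carrier G" for g
  proof -
    have "\<forall>j. j \<notin> {..<v} \<longrightarrow> shift g j = j" by (simp add: shift_def)
    then show ?thesis using shift_bij[OF that] by (simp add: permutes_def bij_iff)
  qed
  have inv_shift: "inv_into UNIV (shift g) = shift (inv\<^bsub>G\<^esub> g)" if "g \<in> carrier G" for g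
    using shift_inv[OF that] by (intro inv_unique_comp) auto
  have shift_fix: "shift g j \<noteq> j" if g: "g \<in> carrier G" "g \<noteq> \<one>\<^bsub>G\<^esub>" and j: "j < v" for g j
  proof
    assume "shift g j = j"
    then have "c (c' (inv\<^bsub>G\<^esub> g \<otimes>\<^bsub>G\<^esub> c j)) = c j" using j by (simp add: shift_def)
    then have "inv\<^bsub>G\<^esub> g \<otimes>\<^bsub>G\<^esub> c j = c j" using g j by (simp add: c1 c2)
    then have "inv\<^bsub>G\<^esub> g = \<one>\<^bsub>G\<^esub>" using g c1(1)[OF j] G.r_cancel_one by auto
    then show False using g by auto
  qed
  \<comment> \<open>The permutation depends only on the row of a codeword, not on its scalar; the
    choice is unambiguous by \<open>codeword_eq_iff\<close>.\<close>
  define \<pi> where "\<pi> x = shift (r (SOME i. i < v \<and> (\<exists>\<alpha>. x = codeword H i \<alpha>)))" for x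
  have \<pi>: "\<pi> (codeword H i \<alpha>) = shift (r i)" if "i < v" for i \<alpha>
  proof -
    have "(SOME l. l < v \<and> (\<exists>\<beta>. codeword H i \<alpha> = codeword H l \<beta>)) = i"
      by (rule some_equality) (use that in \<open>auto simp: codeword_eq_iff\<close>)
    then show ?thesis by (simp add: \<pi>_def)
  qed
  define code where "code = (\<lambda>(u, g). codeword H (r' g) (inv_into UNIV \<phi> u))"
  have \<phi>_inv: "\<phi> (inv_into UNIV \<phi> u) = u" if "u \<in> carrier K" for u
    using bij that by (simp add: bij_betw_inv_into_right)
  \<comment> \<open>At coordinate \<open>j\<close> the permuted second codeword is read at the
    column labelled g (c j). The cocycle identity for h, g, c j turns \<psi>(g, c j) \<psi>(h, g (c
    j)) into \<psi>(h, g) \<psi>(h g, c j): again a row, plus a scalar.\<close>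
  have star_code: "star \<pi> (codeword H (r' g) \<alpha>) (codeword H (r' h) \<beta>) =
      codeword H (r' (h \<otimes>\<^bsub>G\<^esub> g)) (\<alpha> + \<beta> + inv_into UNIV \<phi> (\<psi> h g))"
    if gh: "g \<in> carrier G" "h \<in> carrier G" for g h \<alpha> \<beta>
  proof (rule eq_vecI)
    fix j assume "j < dim_vec (codeword H (r' (h \<otimes>\<^bsub>G\<^esub> g)) (\<alpha> + \<beta> + inv_into UNIV \<phi> (\<psi> h g)))"
    then have j: "j < v" by simp
    have s: "shift (inv\<^bsub>G\<^esub> g) j < v" "c (shift (inv\<^bsub>G\<^esub> g) j) = g \<otimes>\<^bsub>G\<^esub> c j"
      using gh j by (auto simp: shift_def c1 c2)
    have "\<phi> (H $$ (r' g, j) + H $$ (r' h, shift (inv\<^bsub>G\<^esub> g) j)) =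
        \<psi> g (c j) \<otimes>\<^bsub>K\<^esub> \<psi> h (g \<otimes>\<^bsub>G\<^esub> c j)"
      using gh j s by (simp add: add rc')
    also have "\<dots> = \<psi> h g \<otimes>\<^bsub>K\<^esub> \<psi> (h \<otimes>\<^bsub>G\<^esub> g) (c j)"
      using gh j by (simp add: \<psi>_co c1 K.m_comm)
    also have "\<dots> = \<phi> (inv_into UNIV \<phi> (\<psi> h g) + H $$ (r' (h \<otimes>\<^bsub>G\<^esub> g), j))"
      using gh j by (simp add: add rc' \<phi>_inv)
    finally have "H $$ (r' g, j) + H $$ (r' h, shift (inv\<^bsub>G\<^esub> g) j) =
        inv_into UNIV \<phi> (\<psi> h g) + H $$ (r' (h \<otimes>\<^bsub>G\<^esub> g), j)"
      by (simp only: \<phi>_inj)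
    then show "star \<pi> (codeword H (r' g) \<alpha>) (codeword H (r' h) \<beta>) $ j =
        codeword H (r' (h \<otimes>\<^bsub>G\<^esub> g)) (\<alpha> + \<beta> + inv_into UNIV \<phi> (\<psi> h g)) $ j"
      using j s gh by (simp add: star_def perm_vec_def \<pi> r2 inv_shift algebra_simps)
  qed (simp add: star_def perm_vec_def)
  have code_anti: "code (x \<otimes>\<^bsub>extension_group G K \<psi>\<^esub> y) = star \<pi> (code y) (code x)"
    if "x \<in> carrier (extension_group G K \<psi>)" "y \<in> carrier (extension_group G K \<psi>)" for x y
  proof -
    obtain u g w h where [simp]: "x = (u, g)" "y = (w, h)"
      and cl [simp]: "u \<in> carrier K" "w \<in> carrier K" "g \<in> carrier G" "h \<in> carrier G"
      using \<open>x \<in> _\<close> \<open>y \<in> _\<close> by (auto simp: extension_group_def)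
    have "\<phi> (inv_into UNIV \<phi> (u \<otimes>\<^bsub>K\<^esub> w \<otimes>\<^bsub>K\<^esub> \<psi> g h)) =
        \<phi> (inv_into UNIV \<phi> w + inv_into UNIV \<phi> u + inv_into UNIV \<phi> (\<psi> g h))"
      by (simp add: add \<phi>_inv K.m_comm)
    then show ?thesis
      by (simp add: \<phi>_inj extension_group_def code_def star_code)
  qed
  have code_bij: "bij_betw code (carrier (extension_group G K \<psi>)) (C_code H)"
  proof -
    have "bij_betw (\<lambda>(u, g). (r' g, inv_into UNIV \<phi> u)) (carrier K \<times> carrier G) ({..<v} \<times> UNIV)"
      by (rule bij_betw_byWitness[where f' = "\<lambda>(i, \<alpha>). (\<phi> \<alpha>, r i)"])
        (use bij in \<open>auto simp: r1 r2 \<phi>_inv bij_betw_def\<close>)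
    from bij_betw_trans[OF this C_code_bij] show ?thesis
      by (simp add: code_def extension_group_def o_def case_prod_unfold)
  qed
  have "finite (C_code H)" by (simp add: C_code_eq)
  then have finite_E: "finite (carrier (extension_group G K \<psi>))"
    using bij_betw_finite[OF code_bij] by simp
  have code_E: "\<exists>g \<alpha>. g \<in> carrier G \<and> x = codeword H (r' g) \<alpha>" if "x \<in> C_code H" for x
    using that r1 by (metis in_C_E)
  have fp: "full_propelinear v (C_code H) \<pi>"
    unfolding full_propelinear_def
  proof (intro conjI ballI impI)
    show "C_code H \<subseteq> carrier_vec v" by (auto simp: C_code_eq intro!: carrier_vecI)
    show "0\<^sub>v v \<in> C_code H" unfolding zero_eq_codeword by auto
  next
    fix x assume x: "x \<in> C_code H"
    then obtain i \<alpha> where [simp]: "i < v" "x = codeword H i \<alpha>" by (rule in_C_E)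
    show "\<pi> x permutes {..<v}" by (simp add: \<pi> shift_permutes r1)
    show "\<forall>j<v. \<pi> x j \<noteq> j" if "x \<notin> {\<alpha> \<cdot>\<^sub>v all_one_vec v | \<alpha>. True}"
      using that by (simp add: codeword_constant_iff \<pi> shift_fix r_eq_one r1)
    show "\<pi> x = id" if "x \<in> {\<alpha> \<cdot>\<^sub>v all_one_vec v | \<alpha>. True}"
      using that by (simp add: codeword_constant_iff \<pi> r_0 shift_one)
    have "x \<in> code ` carrier (extension_group G K \<psi>)"
      using x code_bij by (simp add: bij_betw_def)
    then obtain e where e: "e \<in> carrier (extension_group G K \<psi>)" "x = code e" by blast
    show "star \<pi> x ` C_code H = C_code H"
    proof -
      \<comment> \<open>Through \<open>code\<close>, star multiplication by \<open>x\<close> from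
        the left is right multiplication by \<open>e\<close> in the extension group, an injection of
        a finite set into itself.\<close>
      have "star \<pi> x ` code ` carrier (extension_group G K \<psi>) =
          code ` (\<lambda>f. f \<otimes>\<^bsub>extension_group G K \<psi>\<^esub> e) ` carrier (extension_group G K \<psi>)"
        using e by (auto simp: code_anti image_image intro!: image_cong)
      also have "(\<lambda>f. f \<otimes>\<^bsub>extension_group G K \<psi>\<^esub> e) ` carrier (extension_group G K \<psi>) =
          carrier (extension_group G K \<psi>)"
        using E.inj_on_multc[OF e(1)] E.m_closed[OF _ e(1)] finite_E by (intro endo_inj_surj) auto
      finally show ?thesis using code_bij by (simp add: bij_betw_def)
    qed
    fix y assume "y \<in> C_code H"
    obtain g \<alpha>' where g: "g \<in> carrier G" "x = codeword H (r' g) \<alpha>'" using code_E[OF x] by blast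
    obtain h \<beta> where h: "h \<in> carrier G" "y = codeword H (r' h) \<beta>"
      using code_E[OF \<open>y \<in> _\<close>] by blast
    show "\<pi> (star \<pi> x y) = \<pi> x \<circ> \<pi> y"
      unfolding g(2) h(2) using g(1) h(1) by (simp add: star_code \<pi> r2 shift_mult)
  qed
  moreover have "gen_hadamard_code v (C_code H)"
    using GH by (auto simp: gen_hadamard_code_def)
  ultimately have "GHFP v (C_code H) \<pi>" by (simp add: GHFP_def)
  moreover have "extension_group G K \<psi> \<cong> star_group v (C_code H) \<pi>"
    by (rule anti_iso_imp_is_iso[OF E.group_axioms, where f = code])
      (use code_bij code_anti in \<open>auto simp: star_group_def\<close>)
  ultimately show ?thesis by blast
qed

section \<open>From full propelinear structures to cocycles\<close>

text \<open>
  Modulo the scalar codewords, which are central, the rows of \<open>H\<close> form a group of order \<open>v\<close> that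
  \<open>\<pi>\<close> lets act regularly on the coordinates. Coordinate \<open>0\<close> of \<open>row j \<star> row i\<close> is the entry of
  \<open>row i\<close> at \<open>\<pi>\<^sub>j\<^sup>-\<^sup>1 0\<close>, so the cocycle of this central extension is \<open>H\<close> itself with its columns
  relabelled by the orbit of coordinate \<open>0\<close>. The group is taken with the opposite multiplication
  so that \<open>i\<close> remains the row index.
\<close>

lemma cocyclic_of_full_propelinear:
  assumes K: "group K" and \<phi>: "\<phi> \<in> iso additive_group K"
    and fp: "full_propelinear v (C_code H) \<pi>"
  shows "\<exists>(G :: nat monoid) \<psi>. order G = v \<and> cocycle G K \<psi> \<and> cocyclic_mat G \<psi> (map_mat \<phi> H) \<and>
    extension_group G K \<psi> \<cong> star_group v (C_code H) \<pi>"
proof -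
  note add = iso_additive_group_add[OF K \<phi>] and zero = iso_additive_group_zero[OF K \<phi>]
    and bij = iso_additive_group_bij[OF K \<phi>]
  interpret K: comm_group K by (rule iso_additive_group_comm[OF K \<phi>])
  have perm: "\<pi> x permutes {..<v}" if "x \<in> C_code H" for x
    using fp that by (simp add: full_propelinear_def)
  have star_image: "star \<pi> x ` C_code H = C_code H" if "x \<in> C_code H" for x
    using fp that by (simp add: full_propelinear_def)
  have star_C: "star \<pi> x y \<in> C_code H" if "x \<in> C_code H" "y \<in> C_code H" for x y
    using star_image that by blast
  have \<pi>_star: "\<pi> (star \<pi> x y) = \<pi> x \<circ> \<pi> y" if "x \<in> C_code H" "y \<in> C_code H" for x y
    using fp that by (simp add: full_propelinear_def)
  have \<pi>_0: "\<pi> (codeword H 0 \<alpha>) = id" for \<alpha>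
    using fp codeword_in_C[of 0 \<alpha>] codeword_constant_iff[of 0 \<alpha>]
    unfolding full_propelinear_def by auto
  have \<pi>_fix: "\<pi> (codeword H i \<alpha>) l \<noteq> l" if "i < v" "i \<noteq> 0" "l < v" for i \<alpha> l
    using fp codeword_in_C[of i \<alpha>] codeword_constant_iff[of i \<alpha>] that
    unfolding full_propelinear_def by auto
  have dim_C: "dim_vec x = v" if "x \<in> C_code H" for x
    using that by (auto simp: C_code_eq)
  \<comment> \<open>Scalar codewords are central: permuting a constant vector changes nothing, and
    \<open>\<pi>\<close> of a scalar codeword is the identity.\<close>
  have star_0_right: "star \<pi> (codeword H i \<alpha>) (codeword H 0 \<beta>) = codeword H i (\<alpha> + \<beta>)"
    if i: "i < v" for i \<alpha> \<beta>
  proof -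
    have "inv_into UNIV (\<pi> (codeword H i \<alpha>)) j < v" if "j < v" for j
      using permutes_in_image[OF permutes_inv[OF perm[OF codeword_in_C[OF i, of \<alpha>]]], of j] that
      by simp
    then show ?thesis by (auto simp: star_def perm_vec_def algebra_simps intro!: eq_vecI)
  qed
  have star_0_left: "star \<pi> (codeword H 0 \<alpha>) (codeword H i \<beta>) = codeword H i (\<alpha> + \<beta>)" for i \<alpha> \<beta>
    by (auto simp: star_def perm_vec_def \<pi>_0 algebra_simps intro!: eq_vecI)
  \<comment> \<open>Each codeword is its row star a scalar codeword, whose permutation is
    trivial.\<close>
  have \<pi>_codeword: "\<pi> (codeword H i \<alpha>) = \<pi> (codeword H i 0)" if "i < v" for i \<alpha>
    using \<pi>_star[of "codeword H i 0" "codeword H 0 \<alpha>"] that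
    by (simp add: star_0_right \<pi>_0 codeword_in_C)
  have star_assoc: "star \<pi> (star \<pi> x y) z = star \<pi> x (star \<pi> y z)"
    if "x \<in> C_code H" "y \<in> C_code H" "z \<in> C_code H" for x y z
  proof -
    have d: "dim_vec (perm_vec p w) = dim_vec w" for p and w :: "'f vec"
      by (simp add: perm_vec_def)
    have "star \<pi> (star \<pi> x y) z = x + perm_vec (\<pi> x) y + perm_vec (\<pi> x) (perm_vec (\<pi> y) z)"
      using that perm by (simp add: star_def[of \<pi> "star \<pi> x y"] \<pi>_star perm_vec_comp dim_C)
        (simp add: star_def)
    also have "\<dots> = x + (perm_vec (\<pi> x) y + perm_vec (\<pi> x) (perm_vec (\<pi> y) z))"
      using that by (intro assoc_add_vec[of _ v]) (auto intro!: carrier_vecI simp: d dim_C)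
    also have "\<dots> = star \<pi> x (star \<pi> y z)"
      using that perm by (simp add: star_def perm_vec_add dim_C d)
    finally show ?thesis .
  qed
  \<comment> \<open>The coordinate that the permutation of row \<open>j\<close> sends to 0.
    Coordinate 0 is the base point because there a codeword shows its scalar.\<close>
  define c' where "c' j = inv_into UNIV (\<pi> (codeword H j 0)) 0" for j
  have c'_lt: "c' j < v" if "j < v" for j
    using permutes_in_image[OF permutes_inv[OF perm[OF codeword_in_C[OF that]]], of 0 0]
    by (simp add: c'_def)
  have \<pi>_c': "\<pi> (codeword H j 0) (c' j) = 0" if "j < v" for j
    using perm[OF codeword_in_C[OF that]] unfolding c'_def by (rule permutes_inverses)
  define m where "m i j = (SOME l. l < v \<and>
      (\<exists>\<gamma>. star \<pi> (codeword H j 0) (codeword H i 0) = codeword H l \<gamma>))" for i j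
  have star_codeword: "star \<pi> (codeword H j \<beta>) (codeword H i \<alpha>) =
      codeword H (m i j) (\<alpha> + \<beta> + H $$ (i, c' j))"
    and m_lt: "m i j < v" if ij: "i < v" "j < v" for i j \<alpha> \<beta>
  proof -
    have "star \<pi> (codeword H j 0) (codeword H i 0) \<in> C_code H"
      using ij by (intro star_C) auto
    then have "\<exists>l. l < v \<and> (\<exists>\<gamma>. star \<pi> (codeword H j 0) (codeword H i 0) = codeword H l \<gamma>)"
      by (metis in_C_E)
    then have "m i j < v \<and>
        (\<exists>\<gamma>. star \<pi> (codeword H j 0) (codeword H i 0) = codeword H (m i j) \<gamma>)"
      unfolding m_def by (rule someI_ex)
    then obtain \<gamma> where m: "m i j < v"
      and \<gamma>: "star \<pi> (codeword H j 0) (codeword H i 0) = codeword H (m i j) \<gamma>"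
      by blast
    show "m i j < v" by (rule m)
    \<comment> \<open>Evaluation at coordinate 0, where rows \<open>m i j\<close> and
      \<open>j\<close> vanish, leaves only the permuted row \<open>i\<close>.\<close>
    have "\<gamma> = star \<pi> (codeword H j 0) (codeword H i 0) $ 0" using m by (simp add: \<gamma>)
    also have "\<dots> = H $$ (i, c' j)"
      using ij c'_lt by (simp add: star_def perm_vec_def flip: c'_def)
    finally have \<gamma>': "\<gamma> = H $$ (i, c' j)" .
    have lt: "inv_into UNIV (\<pi> (codeword H j 0)) l < v" if "l < v" for l
      using permutes_in_image[OF permutes_inv[OF perm[OF codeword_in_C[OF ij(2)]]], of 0 l] that
      by simp
    show "star \<pi> (codeword H j \<beta>) (codeword H i \<alpha>) =
        codeword H (m i j) (\<alpha> + \<beta> + H $$ (i, c' j))"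
    proof (rule eq_vecI)
      fix l assume "l < dim_vec (codeword H (m i j) (\<alpha> + \<beta> + H $$ (i, c' j)))"
      then have l: "l < v" by simp
      show "star \<pi> (codeword H j \<beta>) (codeword H i \<alpha>) $ l =
          codeword H (m i j) (\<alpha> + \<beta> + H $$ (i, c' j)) $ l"
        using arg_cong[OF \<gamma>, of "\<lambda>x. x $ l"] l lt[OF l] ij(2)
        by (simp add: star_def perm_vec_def \<pi>_codeword[of j \<beta>] \<gamma>' algebra_simps)
    qed (simp add: star_def perm_vec_def)
  qed
  have m_assoc_co: "m (m i j) l = m i (m j l)"
      "H $$ (i, c' j) + H $$ (m i j, c' l) = H $$ (i, c' (m j l)) + H $$ (j, c' l)"
    if "i < v" "j < v" "l < v" for i j l
  proof -
    \<comment> \<open>Associativity of the star for rows \<open>l\<close>, \<open>j\<close>,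
      \<open>i\<close>, compared by row and by scalar: rows give associativity of \<open>m\<close>,
      scalars the cocycle identity.\<close>
    have *: "m i (m j l) = m (m i j) l \<and>
        H $$ (j, c' l) + H $$ (i, c' (m j l)) = H $$ (i, c' j) + H $$ (m i j, c' l)"
      using star_assoc[of "codeword H l 0" "codeword H j 0" "codeword H i 0"] that
      by (simp add: star_codeword m_lt codeword_eq_iff codeword_in_C)
    then show "m (m i j) l = m i (m j l)" by simp
    from * show "H $$ (i, c' j) + H $$ (m i j, c' l) = H $$ (i, c' (m j l)) + H $$ (j, c' l)"
      by (metis add.commute)
  qed
  have c'_0: "c' 0 = 0" by (simp add: c'_def \<pi>_0)
  have m_0_left: "m 0 j = j" if "j < v" for j
    using star_0_right[of j 0 0] star_codeword[of 0 j 0 0] that m_lt[of 0 j]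
    by (simp add: codeword_eq_iff c'_lt)
  have m_0_right: "m i 0 = i" if "i < v" for i
    using star_0_left[of 0 i 0] star_codeword[of i 0 0 0] that m_lt[of i 0]
    by (simp add: codeword_eq_iff c'_0)
  define G where "G = \<lparr>carrier = {..<v}, mult = m, one = 0\<rparr>"
  have G: "group G"
  proof (rule groupI)
    fix j assume "j \<in> carrier G"
    then have j: "j < v" by (simp add: G_def)
    \<comment> \<open>A left inverse exists because star multiplication by row \<open>j\<close> maps
      onto the code and hence reaches the zero word.\<close>
    have "codeword H 0 0 \<in> star \<pi> (codeword H j 0) ` C_code H"
      by (simp add: star_image codeword_in_C j)
    then obtain x where x: "x \<in> C_code H" "codeword H 0 0 = star \<pi> (codeword H j 0) x" by blast
    obtain i \<alpha> where i: "i < v" "x = codeword H i \<alpha>" using x(1) by (rule in_C_E)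
    have "codeword H 0 0 = codeword H (m i j) (\<alpha> + 0 + H $$ (i, c' j))"
      using x(2) unfolding i(2) star_codeword[OF i(1) j] .
    then have "m i j = 0" by (simp add: codeword_eq_iff m_lt i j)
    then show "\<exists>i\<in>carrier G. i \<otimes>\<^bsub>G\<^esub> j = \<one>\<^bsub>G\<^esub>" using i by (auto simp: G_def)
  qed (auto simp: G_def m_lt m_assoc_co(1) m_0_left)
  interpret G: group G by (rule G)
  have \<pi>_m: "\<pi> (codeword H (m i j) 0) = \<pi> (codeword H j 0) \<circ> \<pi> (codeword H i 0)"
    if "i < v" "j < v" for i j
    using \<pi>_star[of "codeword H j 0" "codeword H i 0"] that
    by (simp add: star_codeword codeword_in_C m_lt \<pi>_codeword[of _ "H $$ (i, c' j)"])
  have c'_inj: "inj_on c' {..<v}"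
  proof (rule inj_onI)
    fix i j assume "i \<in> {..<v}" "j \<in> {..<v}" and eq: "c' i = c' j"
    then have ij: "i < v" "j < v" by auto
    \<comment> \<open>The permutation of \<open>i'\<close> undoes that of \<open>i\<close>, so it
      sends 0 to \<open>c' i = c' j\<close>. Hence the permutation of \<open>m j i'\<close> fixes
      \<open>c' j\<close>, which only row 0 allows, and cancelling \<open>i'\<close> gives
      \<open>i = j\<close>.\<close>
    define i' where "i' = inv\<^bsub>G\<^esub> i"
    have i': "i' < v" "m i i' = 0"
      using G.inv_closed[of i] G.r_inv[of i] ij by (auto simp: i'_def G_def)
    have "\<pi> (codeword H i' 0) 0 = c' i"
      using \<pi>_m[OF ij(1) i'(1)] \<pi>_c'[OF ij(1)] i'(2) \<pi>_0[of 0] by (metis comp_apply id_apply)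
    then have "\<pi> (codeword H (m j i') 0) (c' j) = c' j"
      using \<pi>_m[OF ij(2) i'(1)] \<pi>_c'[OF ij(2)] eq by simp
    then have "m j i' = 0"
      using \<pi>_fix[of "m j i'" "c' j" 0] m_lt[OF ij(2) i'(1)] c'_lt[OF ij(2)] by blast
    then have "j \<otimes>\<^bsub>G\<^esub> i' = i \<otimes>\<^bsub>G\<^esub> i'" using i' by (simp add: G_def)
    then show "i = j" using G.right_cancel[of i' j i] ij i' by (simp add: G_def)
  qed
  have c'_bij: "bij_betw c' {..<v} {..<v}"
    unfolding bij_betw_def using c'_inj c'_lt
    by (intro conjI endo_inj_surj) auto
  define \<psi> where "\<psi> i j = \<phi> (H $$ (i, c' j))" for i j
  have \<phi>_closed [simp]: "\<phi> a \<in> carrier K" for a using bij by (auto dest: bij_betwE)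
  \<comment> \<open>\<psi> is normalized because row 0 and column 0 of \<open>H\<close> vanish and
    \<open>c' 0 = 0\<close>.\<close>
  have co: "cocycle G K \<psi>"
    using G m_assoc_co(2)
    by (auto simp: cocycle_def G_def \<psi>_def c'_lt c'_0 zero simp flip: add)
  have cm: "cocyclic_mat G \<psi> (map_mat \<phi> H)"
    unfolding cocyclic_mat_def
  proof (intro exI conjI allI impI)
    show "bij_betw id {..<dim_row (map_mat \<phi> H)} (carrier G)" by (simp add: G_def)
    \<comment> \<open>Column \<open>c' j\<close> carries the label \<open>j\<close>, so columns are
      indexed by the inverse of \<open>c'\<close>.\<close>
    show "bij_betw (inv_into {..<v} c') {..<dim_col (map_mat \<phi> H)} (carrier G)"
      using bij_betw_inv_into[OF c'_bij] by (simp add: G_def)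
    fix i j assume "i < dim_row (map_mat \<phi> H)" "j < dim_col (map_mat \<phi> H)"
    then show "map_mat \<phi> H $$ (i, j) = \<psi> (id i) (inv_into {..<v} c' j)"
      using bij_betw_inv_into_right[OF c'_bij, of j] by (simp add: \<psi>_def)
  qed
  have E: "group (extension_group G K \<psi>)"
    using K.comm_group_axioms co by (rule group_extension_group)
  define \<phi>' where "\<phi>' = inv_into UNIV \<phi>"
  have \<phi>': "\<phi>' (\<phi> a) = a" "u \<in> carrier K \<Longrightarrow> \<phi> (\<phi>' u) = u" for a u
    using bij by (simp_all add: \<phi>'_def bij_betw_def f_inv_into_f)
  define code where "code = (\<lambda>(u, i). codeword H i (\<phi>' u))"
  have "bij_betw (\<lambda>(u, i). (i, \<phi>' u)) (carrier K \<times> {..<v}) ({..<v} \<times> UNIV)"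
    by (rule bij_betw_byWitness[where f' = "\<lambda>(i, \<alpha>). (\<phi> \<alpha>, i)"]) (auto simp: \<phi>')
  from bij_betw_trans[OF this C_code_bij]
  have code_bij: "bij_betw code (carrier (extension_group G K \<psi>)) (C_code H)"
    by (simp add: code_def extension_group_def G_def o_def case_prod_unfold)
  have \<phi>'_mult: "\<phi>' (u \<otimes>\<^bsub>K\<^esub> w) = \<phi>' u + \<phi>' w" if "u \<in> carrier K" "w \<in> carrier K" for u w
    using that by (metis \<phi>' add)
  have "extension_group G K \<psi> \<cong> star_group v (C_code H) \<pi>"
  proof (rule anti_iso_imp_is_iso[OF E, where f = code])
    fix x y assume "x \<in> carrier (extension_group G K \<psi>)" "y \<in> carrier (extension_group G K \<psi>)"
    then show "code (x \<otimes>\<^bsub>extension_group G K \<psi>\<^esub> y) =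
        code y \<otimes>\<^bsub>star_group v (C_code H) \<pi>\<^esub> code x"
      by (auto simp: extension_group_def star_group_def G_def code_def star_codeword \<psi>_def
          \<phi>'_mult \<phi>')
  qed (use code_bij in \<open>simp add: star_group_def\<close>)
  moreover have "order G = v" by (simp add: G_def order_def)
  ultimately show ?thesis using co cm by blast
qed

end

section \<open>The equivalence and the isomorphisms\<close>

theorem corollary3p5:
  fixes H :: "'f::{field,finite} mat"
    and v q :: nat
    and K :: "'k monoid"
    and \<phi> :: "'f \<Rightarrow> 'k"
    and k :: "nat \<Rightarrow> 'k"
  assumes q: "q = CARD('f)"
    and GH: "GH v H" and normalized: "normalized_mat H"
    and K: "group K" and \<phi>: "\<phi> \<in> iso additive_group K"
    and k: "bij_betw k {..<q} (carrier K)" "k 0 = \<one>\<^bsub>K\<^esub>"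
  shows
    "(GHFP_code v (C_code H) \<longleftrightarrow>
        (\<exists>(G :: nat monoid) \<psi>. cocycle G K \<psi> \<and> cocyclic_mat G \<psi> (map_mat \<phi> H)))
     \<and>
     (\<forall>\<pi>. GHFP v (C_code H) \<pi> \<longrightarrow>
        (\<exists>(G :: nat monoid) \<psi> R.
           order G = v \<and> cocycle G K \<psi> \<and> cocyclic_mat G \<psi> (map_mat \<phi> H) \<and>
           regular_subgroup R (expanded_mat K q k (map_mat \<phi> H)) \<and>
           extension_group G K \<psi> \<cong> PAut (expanded_mat K q k (map_mat \<phi> H)) \<lparr>carrier := R\<rparr> \<and>
           PAut (expanded_mat K q k (map_mat \<phi> H)) \<lparr>carrier := R\<rparr> \<cong> star_group v (C_code H) \<pi>))
     \<and>
     (\<forall>(G :: 'g monoid) \<psi>. cocycle G K \<psi> \<and> cocyclic_mat G \<psi> (map_mat \<phi> H) \<longrightarrow>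
        (\<exists>\<pi> R.
           GHFP v (C_code H) \<pi> \<and>
           regular_subgroup R (expanded_mat K q k (map_mat \<phi> H)) \<and>
           star_group v (C_code H) \<pi> \<cong> extension_group G K \<psi> \<and>
           extension_group G K \<psi> \<cong> PAut (expanded_mat K q k (map_mat \<phi> H)) \<lparr>carrier := R\<rparr>))"
proof -
  interpret normalized_GH H v by unfold_locales (fact GH normalized)+
  have comm: "comm_group K" by (rule iso_additive_group_comm[OF K \<phi>])
  have M: "map_mat \<phi> H \<in> carrier_mat v v" by simp
  note regular = regular_subgroup_of_cocyclic[OF comm k(1) _ M v_pos]
  note E = group_extension_group[OF comm]
  have fp: "full_propelinear v (C_code H) \<pi>" if "GHFP v (C_code H) \<pi>" for \<pi>
    using that by (simp add: GHFP_def)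
  \<comment> \<open>Groups on natural numbers suffice for the equivalence: the group built from a
    propelinear structure lives on the row indices.\<close>
  have "GHFP_code v (C_code H) \<longleftrightarrow>
      (\<exists>(G :: nat monoid) \<psi>. cocycle G K \<psi> \<and> cocyclic_mat G \<psi> (map_mat \<phi> H))"
  proof
    assume "GHFP_code v (C_code H)"
    then obtain \<pi> where "GHFP v (C_code H) \<pi>" by (auto simp: GHFP_code_def)
    from cocyclic_of_full_propelinear[OF K \<phi> fp[OF this]]
    show "\<exists>(G :: nat monoid) \<psi>. cocycle G K \<psi> \<and> cocyclic_mat G \<psi> (map_mat \<phi> H)" by blast
  next
    assume "\<exists>(G :: nat monoid) \<psi>. cocycle G K \<psi> \<and> cocyclic_mat G \<psi> (map_mat \<phi> H)"
    then obtain G :: "nat monoid" and \<psi>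
      where "cocycle G K \<psi>" "cocyclic_mat G \<psi> (map_mat \<phi> H)" by blast
    from GHFP_of_cocyclic[OF K \<phi> this]
    show "GHFP_code v (C_code H)" by (auto simp: GHFP_code_def)
  qed
  moreover have "\<exists>(G :: nat monoid) \<psi> R.
      order G = v \<and> cocycle G K \<psi> \<and> cocyclic_mat G \<psi> (map_mat \<phi> H) \<and>
      regular_subgroup R (expanded_mat K q k (map_mat \<phi> H)) \<and>
      extension_group G K \<psi> \<cong> PAut (expanded_mat K q k (map_mat \<phi> H)) \<lparr>carrier := R\<rparr> \<and>
      PAut (expanded_mat K q k (map_mat \<phi> H)) \<lparr>carrier := R\<rparr> \<cong> star_group v (C_code H) \<pi>"
    if GHFP: "GHFP v (C_code H) \<pi>" for \<pi>
  proof -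
    obtain G :: "nat monoid" and \<psi> where G: "order G = v" "cocycle G K \<psi>"
      "cocyclic_mat G \<psi> (map_mat \<phi> H)" "extension_group G K \<psi> \<cong> star_group v (C_code H) \<pi>"
      using cocyclic_of_full_propelinear[OF K \<phi> fp[OF GHFP]] by blast
    obtain R where R: "regular_subgroup R (expanded_mat K q k (map_mat \<phi> H))"
      "extension_group G K \<psi> \<cong> PAut (expanded_mat K q k (map_mat \<phi> H)) \<lparr>carrier := R\<rparr>"
      using regular[OF G(2,3)] by blast
    have "PAut (expanded_mat K q k (map_mat \<phi> H)) \<lparr>carrier := R\<rparr> \<cong> star_group v (C_code H) \<pi>"
      using group.iso_sym[OF E[OF G(2)] R(2)] G(4) by (rule iso_trans)
    with G R show ?thesis by blast
  qed
  moreover have "\<exists>\<pi> R. GHFP v (C_code H) \<pi> \<and>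
      regular_subgroup R (expanded_mat K q k (map_mat \<phi> H)) \<and>
      star_group v (C_code H) \<pi> \<cong> extension_group G K \<psi> \<and>
      extension_group G K \<psi> \<cong> PAut (expanded_mat K q k (map_mat \<phi> H)) \<lparr>carrier := R\<rparr>"
    if G: "cocycle G K \<psi>" "cocyclic_mat G \<psi> (map_mat \<phi> H)" for G :: "'g monoid" and \<psi>
    using GHFP_of_cocyclic[OF K \<phi> G] regular[OF G] group.iso_sym[OF E[OF G(1)]] by blast
  ultimately show ?thesis by blast
qed

end
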